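(* Let $t\in[0,\infty)$. A random variable $\xi$ on $(\Omega,\mathcal F,\mathsf P)$ is $\mathcal F_t$-measurable if and only if there exists an $\mathcal H$-measurable random variable $\eta$ such that $\xi(\omega)=\eta(\omega)$ for all $\omega\in\{t<\gamma\}$.
   Context: $(\Omega,\mathcal F,\mathsf P)$ is a probability space, $\mathcal H\subset\mathcal F$ is a sub-$\sigma$-algebra, and $\gamma$ is a random variable with values in $[0,\infty]$ such that $\mathsf P(\gamma>0)=1$. For $t\in[0,\infty)$, $\mathcal F_t$ is the collection of all $A\in\mathcal F$ for which there exists $C\in\mathcal H$ with $A\cap\{t<\gamma\}=C\cap\{t<\gamma\}$; $(\mathcal F_t)_{t\ge 0}$ is a right-continuous filtration. Standing assumption: this filtration contains all $\mathsf P$-null sets of $\mathcal F$ (so it satisfies the usual conditions). *)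

theory Defs
  imports "HOL-Probability.Probability"
begin

text \<open>
  The time index is a real number, used only for \<open>t \<ge> 0\<close>; for negative \<open>t\<close> the coercion
  \<open>ennreal\<close> truncates to \<open>0\<close>.
\<close>

definition before_sets ::
    "'a measure \<Rightarrow> 'a measure \<Rightarrow> ('a \<Rightarrow> ennreal) \<Rightarrow> real \<Rightarrow> 'a set set" where
  "before_sets M H \<gamma> t =
     {A \<in> sets M. \<exists>C \<in> sets H.
        A \<inter> {\<omega> \<in> space M. ennreal t < \<gamma> \<omega>} = C \<inter> {\<omega> \<in> space M. ennreal t < \<gamma> \<omega>}}"

text \<open>
  The same collection as a measurable space, so that measurability can be expressed with the
  library notions. Passing to the generated \<open>\<sigma>\<close>-algebra adds no sets, see
  \<open>sets_before_filtration\<close> below.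
\<close>

definition before_filtration ::
    "'a measure \<Rightarrow> 'a measure \<Rightarrow> ('a \<Rightarrow> ennreal) \<Rightarrow> real \<Rightarrow> 'a measure" where
  "before_filtration M H \<gamma> t = sigma (space M) (before_sets M H \<gamma> t)"

lemma sigma_algebra_before_sets:
  assumes "subalgebra M H"
  shows "sigma_algebra (space M) (before_sets M H \<gamma> t)"
proof -
  define T where "T = {\<omega> \<in> space M. ennreal t < \<gamma> \<omega>}"
  have sp: "space H = space M" using assms by (simp add: subalgebra_def)
  have B: "before_sets M H \<gamma> t = {A \<in> sets M. \<exists>C \<in> sets H. A \<inter> T = C \<inter> T}"
    by (simp add: before_sets_def T_def)
  have T: "T \<subseteq> space M" by (auto simp: T_def)
  show ?thesis
    unfolding sigma_algebra_iff2 B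
  proof (intro conjI ballI allI impI)
    show "{A \<in> sets M. \<exists>C\<in>sets H. A \<inter> T = C \<inter> T} \<subseteq> Pow (space M)"
      using sets.sets_into_space by auto
    show "{} \<in> {A \<in> sets M. \<exists>C\<in>sets H. A \<inter> T = C \<inter> T}" by auto
  next
    fix A assume "A \<in> {A \<in> sets M. \<exists>C\<in>sets H. A \<inter> T = C \<inter> T}"
    then obtain C where C: "A \<in> sets M" "C \<in> sets H" "A \<inter> T = C \<inter> T" by auto
    have "(space M - A) \<inter> T = (space H - C) \<inter> T" using C(3) T sp by auto
    then show "space M - A \<in> {A \<in> sets M. \<exists>C\<in>sets H. A \<inter> T = C \<inter> T}"
      using C by blast
  next
    fix A :: "nat \<Rightarrow> 'a set"
    assume "range A \<subseteq> {A \<in> sets M. \<exists>C\<in>sets H. A \<inter> T = C \<inter> T}"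
    then have A: "A n \<in> sets M" "\<exists>C\<in>sets H. A n \<inter> T = C \<inter> T" for n by auto
    from A(2) obtain C where C: "\<And>n. C n \<in> sets H" "\<And>n. A n \<inter> T = C n \<inter> T" by metis
    have "(\<Union>n. A n) \<inter> T = (\<Union>n. C n) \<inter> T" using C(2) by auto
    moreover have "(\<Union>n. A n) \<in> sets M" "(\<Union>n. C n) \<in> sets H" using A C by auto
    ultimately show "(\<Union>n. A n) \<in> {A \<in> sets M. \<exists>C\<in>sets H. A \<inter> T = C \<inter> T}" by blast
  qed
qed

lemma space_before_filtration [simp]: "space (before_filtration M H \<gamma> t) = space M"
  by (simp add: before_filtration_def space_measure_of_conv)

lemma sets_before_filtration:
  assumes "subalgebra M H"
  shows "sets (before_filtration M H \<gamma> t) = before_sets M H \<gamma> t"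
  unfolding before_filtration_def
  by (rule sigma_algebra.sets_measure_of_eq[OF sigma_algebra_before_sets[OF assms]])

lemma filtration_before_filtration:
  assumes "subalgebra M H"
  shows "filtration (space M) (before_filtration M H \<gamma>)"
proof
  fix s t :: real assume "s \<le> t"
  then have le: "ennreal s \<le> ennreal t" by (rule ennreal_leI)
  show "sets (before_filtration M H \<gamma> s) \<subseteq> sets (before_filtration M H \<gamma> t)"
    unfolding sets_before_filtration[OF assms]
  proof
    fix A assume "A \<in> before_sets M H \<gamma> s"
    then obtain C where C: "A \<in> sets M" "C \<in> sets H"
      "A \<inter> {\<omega> \<in> space M. ennreal s < \<gamma> \<omega>} = C \<inter> {\<omega> \<in> space M. ennreal s < \<gamma> \<omega>}"
      by (auto simp: before_sets_def)
    have "A \<inter> {\<omega> \<in> space M. ennreal t < \<gamma> \<omega>} = C \<inter> {\<omega> \<in> space M. ennreal t < \<gamma> \<omega>}"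
      using C(3) le by (fastforce intro: le_less_trans)
    with C(1,2) show "A \<in> before_sets M H \<gamma> t" by (auto simp: before_sets_def)
  qed
qed simp

end

theory Submission
  imports Defs
begin

text \<open>
  On \<open>T = {t < \<gamma>}\<close> the \<open>\<sigma>\<close>-algebra \<open>\<F>\<^sub>t\<close> leaves the same trace as \<open>\<H>\<close>, and off \<open>T\<close> it
  imposes no condition beyond membership in the ambient \<open>\<sigma>\<close>-algebra. Hence a random variable
  is \<open>\<F>\<^sub>t\<close>-measurable exactly when its restriction to \<open>T\<close> is measurable for the trace of
  \<open>\<H>\<close> on \<open>T\<close> (\<open>measurable_before_filtration_iff_trace\<close>). What remains is an
  extension problem: a real function that is measurable for the trace \<open>\<sigma>\<close>-algebra on \<open>T\<close>
  has to be the restriction of a measurable function on the whole space. As \<open>T\<close> need not belong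
  to \<open>\<H>\<close>, extending by zero is not possible; instead the extension is rebuilt from measurable
  sets that cut out the sublevel sets of the function at rational levels
  (\<open>borel_measurable_trace_extension\<close>).
\<close>

text \<open>
  If \<open>C q\<close> is measurable with trace \<open>{f \<le> q}\<close> for each rational \<open>q\<close>, then
  \<open>x \<mapsto> inf {q. x \<in> C q}\<close> is measurable on the whole space, and on the trace it
  recovers \<open>f\<close> because the rationals are dense. Off the trace the sets \<open>C q\<close> need not be nested
  and the infimum can be infinite, so it is formed in the extended reals and converted at the end.
\<close>

lemma borel_measurable_trace_extension:
  fixes f :: "'a \<Rightarrow> real"
  assumes f: "f \<in> borel_measurable (restrict_space N T)"
  obtains g :: "'a \<Rightarrow> real" where "g \<in> borel_measurable N"
    and "\<And>x. x \<in> space N \<inter> T \<Longrightarrow> f x = g x"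
proof -
  have "\<exists>C\<in>sets N. {x \<in> space (restrict_space N T). f x \<le> real_of_rat q} = T \<inter> C" for q
    using borel_measurable_le[OF f borel_measurable_const, of "real_of_rat q"]
    by (auto simp: sets_restrict_space)
  then obtain C where C: "\<And>q. C q \<in> sets N"
    and trace: "\<And>q. {x \<in> space (restrict_space N T). f x \<le> real_of_rat q} = T \<inter> C q"
    by metis
  define h where
    "h x = (INF q. if x \<in> C q then ereal (real_of_rat q) else \<infinity>)" for x
  have "h \<in> borel_measurable N"
    unfolding h_def using C by measurable
  then have "(\<lambda>x. real_of_ereal (h x)) \<in> borel_measurable N"
    by measurable
  moreover have "f x = real_of_ereal (h x)" if x: "x \<in> space N \<inter> T" for x
  proof -
    have mem: "x \<in> C q \<longleftrightarrow> f x \<le> real_of_rat q" for q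
      using trace[of q] x by (auto simp: space_restrict_space)
    have "h x = ereal (f x)"
    proof (rule antisym)
      show "ereal (f x) \<le> h x"
        unfolding h_def by (rule INF_greatest) (simp add: mem)
      show "h x \<le> ereal (f x)"
      proof (rule dense_ge)
        fix z assume "ereal (f x) < z"
        then obtain r where r: "f x < r" "ereal r < z"
          using ereal_dense2 by fastforce
        obtain q where q: "f x < real_of_rat q" "real_of_rat q < r"
          using of_rat_dense[OF r(1)] by blast
        have "h x \<le> ereal (real_of_rat q)"
          unfolding h_def by (rule INF_lower2[of q]) (use q mem in auto)
        also have "\<dots> \<le> z"
          using q(2) r(2) by (meson ereal_less_eq(3) less_imp_le order_trans)
        finally show "h x \<le> z" .
      qed
    qed
    then show ?thesis by simp
  qed
  ultimately show ?thesis by (rule that)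
qed

lemma measurable_before_filtration_iff_trace:
  assumes H: "subalgebra M H" and X: "X \<in> measurable M N"
  shows "X \<in> measurable (before_filtration M H \<gamma> t) N \<longleftrightarrow>
    X \<in> measurable (restrict_space H {\<omega> \<in> space M. ennreal t < \<gamma> \<omega>}) N"
    (is "_ \<longleftrightarrow> X \<in> measurable (restrict_space H ?T) N")
proof -
  have sp: "space H = space M" using H by (simp add: subalgebra_def)
  have space_trace: "space (restrict_space H ?T) = ?T"
    using sp by (auto simp: space_restrict_space)
  have "X -` B \<inter> space M \<in> before_sets M H \<gamma> t \<longleftrightarrow>
      X -` B \<inter> ?T \<in> sets (restrict_space H ?T)" if B: "B \<in> sets N" for B
  proof -
    have "X -` B \<inter> space M \<in> sets M" using X B by (rule measurable_sets)
    moreover have "(X -` B \<inter> space M) \<inter> ?T = X -` B \<inter> ?T" by auto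
    ultimately show ?thesis
      by (auto simp: before_sets_def sets_restrict_space image_iff Int_commute)
  qed
  moreover have "X \<in> space M \<rightarrow> space N" "X \<in> ?T \<rightarrow> space N"
    using measurable_space[OF X] by auto
  ultimately show ?thesis
    by (simp add: measurable_def sets_before_filtration[OF H] space_trace)
qed

theorem proposition2p1:
  fixes M H :: "'a measure" and \<gamma> :: "'a \<Rightarrow> ennreal" and t :: real and \<xi> :: "'a \<Rightarrow> real"
  assumes "prob_space M"
    and "subalgebra M H"
    and "\<gamma> \<in> borel_measurable M"
    and "measure M {\<omega> \<in> space M. 0 < \<gamma> \<omega>} = 1"
    and "\<forall>s\<ge>0. null_sets M \<subseteq> sets (before_filtration M H \<gamma> s)"
    and "t \<ge> 0"
    and "\<xi> \<in> borel_measurable M"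
  shows "\<xi> \<in> borel_measurable (before_filtration M H \<gamma> t) \<longleftrightarrow>
    (\<exists>\<eta> :: 'a \<Rightarrow> real. \<eta> \<in> borel_measurable H \<and>
       (\<forall>\<omega> \<in> space M. ennreal t < \<gamma> \<omega> \<longrightarrow> \<xi> \<omega> = \<eta> \<omega>))"
proof -
  let ?T = "{\<omega> \<in> space M. ennreal t < \<gamma> \<omega>}"
  have sp: "space H = space M" using assms(2) by (simp add: subalgebra_def)
  have "\<xi> \<in> borel_measurable (restrict_space H ?T) \<longleftrightarrow>
    (\<exists>\<eta> :: 'a \<Rightarrow> real. \<eta> \<in> borel_measurable H \<and>
       (\<forall>\<omega> \<in> space M. ennreal t < \<gamma> \<omega> \<longrightarrow> \<xi> \<omega> = \<eta> \<omega>))"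
  proof
    assume "\<xi> \<in> borel_measurable (restrict_space H ?T)"
    then obtain \<eta> :: "'a \<Rightarrow> real" where "\<eta> \<in> borel_measurable H"
      "\<And>\<omega>. \<omega> \<in> space H \<inter> ?T \<Longrightarrow> \<xi> \<omega> = \<eta> \<omega>"
      by (rule borel_measurable_trace_extension) blast
    then show "\<exists>\<eta> :: 'a \<Rightarrow> real. \<eta> \<in> borel_measurable H \<and>
        (\<forall>\<omega> \<in> space M. ennreal t < \<gamma> \<omega> \<longrightarrow> \<xi> \<omega> = \<eta> \<omega>)"
      using sp by blast
  next
    assume "\<exists>\<eta> :: 'a \<Rightarrow> real. \<eta> \<in> borel_measurable H \<and>
        (\<forall>\<omega> \<in> space M. ennreal t < \<gamma> \<omega> \<longrightarrow> \<xi> \<omega> = \<eta> \<omega>)"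
    then obtain \<eta> :: "'a \<Rightarrow> real" where \<eta>: "\<eta> \<in> borel_measurable H"
      "\<forall>\<omega> \<in> space M. ennreal t < \<gamma> \<omega> \<longrightarrow> \<xi> \<omega> = \<eta> \<omega>"
      by blast
    have "\<xi> \<in> borel_measurable (restrict_space H ?T) \<longleftrightarrow>
        \<eta> \<in> borel_measurable (restrict_space H ?T)"
      by (rule measurable_cong) (use \<eta>(2) sp in \<open>auto simp: space_restrict_space\<close>)
    then show "\<xi> \<in> borel_measurable (restrict_space H ?T)"
      using measurable_restrict_space1[OF \<eta>(1)] by blast
  qed
  then show ?thesis
    using measurable_before_filtration_iff_trace[OF assms(2,7)] by simp
qed

end
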